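(* Let $n\ge1$ and let $\{g_\varepsilon\}_{\varepsilon>0}\subset C^{1,1}(\mathbb{R})$ be an admissible smoothing family. Then for $a\in\mathbb{R}^n$ and all $j\in\{1,\ldots,n\}\setminus I_n(a)$ we have $$\lim_{\varepsilon\to0^+}p_{n,j,\varepsilon}(a)=0.$$ If $I_n(a)$ is a singleton, i.e. $I_n(a)=\{\hat i_n(a)\}$, then $$\lim_{\varepsilon\to0^+}p_{n,\hat i_n(a),\varepsilon}(a)=1.$$ Further, if $g_\varepsilon(r)\le(r)_+$ for all $r\in\mathbb{R}$ and all $\varepsilon>0$, and there exists $s_0>0$ such that $\lim_{\varepsilon\to0^+}\sup_{s\in[-s_0,0]}|g_\varepsilon'(s)|=0$, then for all $j\in\{1,\ldots,n\}$ $$\lim_{\varepsilon\to0^+}p_{n,j,\varepsilon}(a)=\begin{cases}1&\text{if }j=\hat i_n(a),\\0&\text{otherwise.}\end{cases}$$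
   Context: $(x)_+=\max\{x,0\}$. A family $\{g_\varepsilon\}_{\varepsilon>0}\subset C^{1,1}(\mathbb{R})$ ($C^1$ functions with Lipschitz derivative) is called an admissible smoothing family if for every $\varepsilon>0$: $g_\varepsilon(x)\ge 0$ and $g_\varepsilon'(x)\in[0,1]$ for all $x\in\mathbb{R}$; $g_\varepsilon''(x)\ge 0$ for almost all $x\in\mathbb{R}$; $\sup_{x\in\mathbb{R}}|(x)_+-g_\varepsilon(x)|\le\varepsilon$; $g_\varepsilon''\in L^\infty(\mathbb{R})$; and, moreover, $g_\varepsilon'\to\chi_{[0,\infty)}$ uniformly on compact subsets of $\mathbb{R}\setminus\{0\}$ as $\varepsilon\to0^+$. For $a\in\mathbb{R}^n$, $\psi_n(a)=\min_{i\in\{1,\ldots,n\}}a_i$. The smoothed minimum is defined recursively by $\psi_{1,\varepsilon}(a)=a_1$ and $\psi_{i+1,\varepsilon}(a)=a_{i+1}-g_\varepsilon(a_{i+1}-\psi_{i,\varepsilon}(a))$ for $i\in\{1,\ldots,n-1\}$. For $j\in\{1,\ldots,n\}$, $p_{n,j,\varepsilon}(a)=\frac{\partial\psi_{n,\varepsilon}}{\partial a_j}(a)$. The active index set is $I_n(a)=\{i\in\{1,\ldots,n\}:\psi_n(a)=a_i\}$ and $\hat i_n(a)=\max I_n(a)$. *)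

theory Defs
  imports "HOL-Analysis.Analysis"
begin

text \<open>Continuity of the derivative need not be listed: it follows from the Lipschitz bound.\<close>

definition C11 :: "(real \<Rightarrow> real) \<Rightarrow> bool" where
  "C11 f \<longleftrightarrow> (\<forall>x. f differentiable (at x)) \<and> (\<exists>L. L-lipschitz_on UNIV (deriv f))"

text \<open>
  Since \<open>deriv (g \<epsilon>)\<close> is Lipschitz, \<open>deriv (deriv (g \<epsilon>))\<close> is the true second derivative outside a
  null set; its values elsewhere do not affect the two almost-everywhere conditions, nor
  measurability, because \<open>lebesgue\<close> is complete.
\<close>

definition admissible_smoothing :: "(real \<Rightarrow> real \<Rightarrow> real) \<Rightarrow> bool" where
  "admissible_smoothing g \<longleftrightarrow>
     (\<forall>\<epsilon>>0. C11 (g \<epsilon>) \<and>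
        (\<forall>x. 0 \<le> g \<epsilon> x) \<and>
        (\<forall>x. deriv (g \<epsilon>) x \<in> {0..1}) \<and>
        (AE x in lebesgue. 0 \<le> deriv (deriv (g \<epsilon>)) x) \<and>
        (\<forall>x. \<bar>max x 0 - g \<epsilon> x\<bar> \<le> \<epsilon>) \<and>
        deriv (deriv (g \<epsilon>)) \<in> borel_measurable lebesgue \<and>
        (\<exists>C. AE x in lebesgue. \<bar>deriv (deriv (g \<epsilon>)) x\<bar> \<le> C)) \<and>
     (\<forall>K. compact K \<and> K \<subseteq> UNIV - {0} \<longrightarrow>
        uniform_limit K (\<lambda>\<epsilon>. deriv (g \<epsilon>)) (indicator {0..}) (at_right 0))"

text \<open>
  A vector in \<open>\<real>\<^sup>n\<close> is represented by a function \<open>a :: nat \<Rightarrow> real\<close>, of which only the values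
  \<open>a 1, \<dots>, a n\<close> are used.
\<close>

definition vmin :: "nat \<Rightarrow> (nat \<Rightarrow> real) \<Rightarrow> real" where
  "vmin n a = Min (a ` {1..n})"

definition active_set :: "nat \<Rightarrow> (nat \<Rightarrow> real) \<Rightarrow> nat set" where
  "active_set n a = {i \<in> {1..n}. vmin n a = a i}"

definition max_active :: "nat \<Rightarrow> (nat \<Rightarrow> real) \<Rightarrow> nat" where
  "max_active n a = Max (active_set n a)"

text \<open>The value for \<open>n = 0\<close> is a dummy; the recursion starts at \<open>n = 1\<close>.\<close>

primrec smoothed_min :: "(real \<Rightarrow> real) \<Rightarrow> nat \<Rightarrow> (nat \<Rightarrow> real) \<Rightarrow> real" where
  "smoothed_min h 0 a = 0"
| "smoothed_min h (Suc i) a =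
     (if i = 0 then a 1 else a (Suc i) - h (a (Suc i) - smoothed_min h i a))"

definition smoothed_min_partial :: "(real \<Rightarrow> real) \<Rightarrow> nat \<Rightarrow> nat \<Rightarrow> (nat \<Rightarrow> real) \<Rightarrow> real" where
  "smoothed_min_partial h n j a = deriv (\<lambda>t. smoothed_min h n (a(j := t))) (a j)"

text \<open>The partial derivatives exist, so \<open>deriv\<close> above is never applied outside its domain.\<close>

lemma smoothed_min_differentiable:
  assumes "\<And>x. h differentiable (at x)"
  shows "(\<lambda>t. smoothed_min h n (a(j := t))) differentiable (at x)"
proof (induction n)
  case 0
  show ?case by simp
next
  case (Suc n)
  have coord: "(\<lambda>t. (a(j := t)) k) differentiable (at x)" for k
    by (cases "k = j") simp_all
  have inner: "(\<lambda>t. (a(j := t)) (Suc n) - smoothed_min h n (a(j := t))) differentiable (at x)"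
    by (rule differentiable_diff[OF coord Suc.IH])
  have outer: "(\<lambda>t. h ((a(j := t)) (Suc n) - smoothed_min h n (a(j := t)))) differentiable (at x)"
    using differentiable_compose[OF assms inner] by simp
  show ?case
  proof (cases "n = 0")
    case True
    then show ?thesis using coord[of 1] by (simp del: fun_upd_apply)
  next
    case False
    then show ?thesis using differentiable_diff[OF coord[of "Suc n"] outer]
      by (simp del: fun_upd_apply)
  qed
qed

lemma smoothed_min_has_partial:
  assumes "C11 h"
  shows "((\<lambda>t. smoothed_min h n (a(j := t))) has_real_derivative
           smoothed_min_partial h n j a) (at (a j))"
  using smoothed_min_differentiable[of h] assms
  unfolding C11_def smoothed_min_partial_def
  by (simp add: DERIV_deriv_iff_real_differentiable)

end

theory Submission
  imports Defs
begin

text \<open>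
  By the chain rule, \<open>p (i+1) j = d i * p i j\<close> for \<open>j \<le> i\<close> and \<open>p (i+1) (i+1) = 1 - d i\<close>, where
  \<open>d i \<in> {0..1}\<close> is the derivative of \<open>g \<epsilon>\<close> at \<open>a (i+1) - \<psi> i\<close>, with \<open>\<psi> i\<close> the smoothed minimum.
  As \<open>\<psi> i\<close> tends to the minimum of the first \<open>i\<close> coordinates, \<open>d i\<close> tends to \<open>0\<close> or \<open>1\<close> except at
  a tie \<open>a (i+1) = vmin i a\<close>. An inactive index either enters with factor \<open>1 - d i \<rightarrow> 0\<close>, or later
  meets a factor \<open>d i \<rightarrow> 0\<close>. The partials sum to \<open>1\<close>, which gives the singleton case. If
  \<open>g \<epsilon> r \<le> max r 0\<close> then \<open>\<psi> i \<ge> vmin i a\<close>, so at a tie \<open>d i\<close> is evaluated at nonpositive points,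
  where the derivative tends to \<open>0\<close>: the newest active index wins.
\<close>

section \<open>Recursion for the minimum and its largest active index\<close>

lemma vmin_1: "vmin (Suc 0) a = a (Suc 0)"
  by (simp add: vmin_def)

lemma vmin_Suc:
  assumes "n \<ge> 1"
  shows "vmin (Suc n) a = min (a (Suc n)) (vmin n a)"
proof -
  have "a ` {1..Suc n} = insert (a (Suc n)) (a ` {1..n})"
    by (simp add: atLeastAtMostSuc_conv)
  then show ?thesis
    using assms by (simp add: vmin_def)
qed

lemma max_active_1: "max_active (Suc 0) a = Suc 0"
proof -
  have "active_set (Suc 0) a = {Suc 0}"
    by (auto simp: active_set_def vmin_1)
  then show ?thesis by (simp add: max_active_def)
qed

text \<open>A strictly larger new coordinate leaves the active set unchanged; otherwise
  \<open>Suc n\<close> is active, and no index in range exceeds it.\<close>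

lemma max_active_Suc:
  assumes "n \<ge> 1"
  shows "max_active (Suc n) a = (if vmin n a < a (Suc n) then max_active n a else Suc n)"
proof (cases "vmin n a < a (Suc n)")
  case True
  then have "active_set (Suc n) a = active_set n a"
    using assms by (auto simp: active_set_def vmin_Suc le_Suc_eq)
  then show ?thesis using True by (simp add: max_active_def)
next
  case False
  then have "Suc n \<in> active_set (Suc n) a"
    using assms by (simp add: active_set_def vmin_Suc)
  then have "max_active (Suc n) a = Suc n"
    unfolding max_active_def by (intro Max_eqI) (auto simp: active_set_def)
  then show ?thesis using False by simp
qed

section \<open>Recursion, bounds and sum of the partial derivatives\<close>

lemma smoothed_min_cong:
  "(\<And>i. i \<in> {1..n} \<Longrightarrow> a i = b i) \<Longrightarrow> smoothed_min h n a = smoothed_min h n b"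
  by (induction n) auto

lemma smoothed_min_partial_1: "smoothed_min_partial h (Suc 0) j a = (if j = Suc 0 then 1 else 0)"
  by (simp add: smoothed_min_partial_def)

text \<open>Evaluates the inner partial in the chain rule at the new index \<open>j = Suc n\<close>,
  on which the earlier smoothed minimum does not depend.\<close>

lemma smoothed_min_partial_beyond:
  assumes "n < j"
  shows "smoothed_min_partial h n j a = 0"
proof -
  have "(\<lambda>t. smoothed_min h n (a(j := t))) = (\<lambda>t. smoothed_min h n a)"
    using assms by (intro ext smoothed_min_cong) auto
  then show ?thesis by (simp add: smoothed_min_partial_def)
qed

text \<open>Chain rule for the defining recursion. The \<open>if\<close> terms are the partial
  derivative of the coordinate \<open>a (Suc n)\<close>, so one formula serves old and new
  indices.\<close>

lemma smoothed_min_partial_Suc: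
  assumes "C11 h" "n \<ge> 1"
  shows "smoothed_min_partial h (Suc n) j a =
    (if j = Suc n then 1 else 0) - deriv h (a (Suc n) - smoothed_min h n a) *
      ((if j = Suc n then 1 else 0) - smoothed_min_partial h n j a)"
proof -
  have dh: "(h has_real_derivative deriv h x) (at x)" for x
    using assms(1) by (simp add: C11_def DERIV_deriv_iff_real_differentiable)
  have coord: "((\<lambda>t. (a(j := t)) (Suc n)) has_real_derivative (if j = Suc n then 1 else 0)) (at (a j))"
    by (cases "j = Suc n") auto
  note inner = DERIV_diff[OF coord smoothed_min_has_partial[OF assms(1), of n a j]]
  have "((\<lambda>t. smoothed_min h (Suc n) (a(j := t))) has_real_derivative
    (if j = Suc n then 1 else 0) - deriv h (a (Suc n) - smoothed_min h n a) *
      ((if j = Suc n then 1 else 0) - smoothed_min_partial h n j a)) (at (a j))"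
    using DERIV_diff[OF coord DERIV_chain2[OF dh inner]] assms(2)
    by (simp del: fun_upd_apply add: fun_upd_triv)
  then show ?thesis
    unfolding smoothed_min_partial_def[of h "Suc n"] by (rule DERIV_imp_deriv)
qed

text \<open>With \<open>d\<close> the derivative factor and \<open>p\<close> the old partial, the
  new one is \<open>1 - d\<close> at \<open>Suc n\<close> and \<open>d * p\<close> at any other
  index.\<close>

lemma smoothed_min_partial_in_unit:
  assumes "C11 h" "\<And>x. deriv h x \<in> {0..1}" "n \<ge> 1"
  shows "smoothed_min_partial h n j a \<in> {0..1}"
  using assms(3)
proof (induction n rule: dec_induct)
  case base
  show ?case by (simp add: smoothed_min_partial_1)
next
  case (step n)
  show ?case
    using step assms(2)[of "a (Suc n) - smoothed_min h n a"]
    by (auto simp: smoothed_min_partial_Suc[OF assms(1)] smoothed_min_partial_beyond mult_le_one)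
qed

text \<open>A step scales the old total by the factor \<open>d\<close> while the new index
  contributes \<open>1 - d\<close>: weight is only redistributed.\<close>

lemma sum_smoothed_min_partial:
  assumes "C11 h" "n \<ge> 1"
  shows "(\<Sum>j=1..n. smoothed_min_partial h n j a) = 1"
  using assms(2)
proof (induction n rule: dec_induct)
  case base
  show ?case by (simp add: smoothed_min_partial_1)
next
  case (step n)
  let ?d = "deriv h (a (Suc n) - smoothed_min h n a)"
  have "(\<Sum>j=1..n. smoothed_min_partial h (Suc n) j a) = ?d * (\<Sum>j=1..n. smoothed_min_partial h n j a)"
    unfolding sum_distrib_left
    using step by (intro sum.cong) (auto simp: smoothed_min_partial_Suc[OF assms(1)])
  then show ?case
    using step by (simp add: smoothed_min_partial_Suc[OF assms(1)] smoothed_min_partial_beyond)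
qed

section \<open>Comparison of the smoothed minimum with the minimum\<close>

text \<open>Since \<open>t - max (t - s) 0 = min t s\<close> is 1-Lipschitz in \<open>s\<close>,
  each step adds an error of at most \<open>\<epsilon>\<close>, and \<open>n\<close> coordinates
  take \<open>n - 1\<close> steps.\<close>

lemma smoothed_min_approx:
  assumes "\<And>x. \<bar>max x 0 - h x\<bar> \<le> \<epsilon>" "n \<ge> 1"
  shows "\<bar>smoothed_min h n a - vmin n a\<bar> \<le> real (n - 1) * \<epsilon>"
  using assms(2)
proof (induction n rule: dec_induct)
  case base
  show ?case by (simp add: vmin_1)
next
  case (step n)
  let ?x = "a (Suc n) - smoothed_min h n a"
  have "\<bar>smoothed_min h (Suc n) a - vmin (Suc n) a\<bar>
      \<le> \<bar>max ?x 0 - h ?x\<bar> + \<bar>smoothed_min h n a - vmin n a\<bar>"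
    using step.hyps by (simp add: vmin_Suc)
  also have "\<dots> \<le> \<epsilon> + real (n - 1) * \<epsilon>"
    using assms(1)[of ?x] step.IH by linarith
  also have "\<dots> = real (Suc n - 1) * \<epsilon>"
    using step.hyps by (simp add: of_nat_diff left_diff_distrib)
  finally show ?case .
qed

text \<open>Replacing \<open>h\<close> by the positive part can only lower a step, and yields the
  exact \<open>min t s\<close>, which is monotone in \<open>s\<close>.\<close>

lemma smoothed_min_ge_vmin:
  assumes "\<And>r. h r \<le> max r 0" "n \<ge> 1"
  shows "vmin n a \<le> smoothed_min h n a"
  using assms(2)
proof (induction n rule: dec_induct)
  case base
  show ?case by (simp add: vmin_1)
next
  case (step n)
  show ?case
    using step assms(1)[of "a (Suc n) - smoothed_min h n a"]
    by (simp add: vmin_Suc)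
qed

section \<open>Limits of the smoothed minimum and of the chain rule factors\<close>

lemma
  assumes "admissible_smoothing g" "\<epsilon> > 0"
  shows admissible_smoothing_C11: "C11 (g \<epsilon>)"
    and admissible_smoothing_deriv: "deriv (g \<epsilon>) x \<in> {0..1}"
    and admissible_smoothing_approx: "\<bar>max x 0 - g \<epsilon> x\<bar> \<le> \<epsilon>"
  using assms by (auto simp: admissible_smoothing_def)

lemma tendsto_smoothed_min:
  assumes "admissible_smoothing g" "n \<ge> 1"
  shows "((\<lambda>\<epsilon>. smoothed_min (g \<epsilon>) n a) \<longlongrightarrow> vmin n a) (at_right 0)"
proof (rule LIM_zero_cancel, rule Lim_null_comparison)
  show "eventually (\<lambda>\<epsilon>. norm (smoothed_min (g \<epsilon>) n a - vmin n a) \<le> real (n - 1) * \<epsilon>) (at_right 0)"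
    using eventually_at_right_less[of "0::real"]
  proof eventually_elim
    case (elim \<epsilon>)
    then show ?case
      using smoothed_min_approx[OF admissible_smoothing_approx[OF assms(1)] assms(2)] by simp
  qed
  show "((\<lambda>\<epsilon>. real (n - 1) * \<epsilon>) \<longlongrightarrow> 0) (at_right 0)"
    using tendsto_mult_right_zero[OF tendsto_ident_at] .
qed

text \<open>The evaluation point moves with \<open>\<epsilon>\<close>, hence the use of uniform
  convergence on a compact neighbourhood of \<open>x\<close>.\<close>

lemma tendsto_admissible_deriv:
  assumes "admissible_smoothing g" "(f \<longlongrightarrow> x) (at_right 0)" "x \<noteq> 0"
  shows "((\<lambda>\<epsilon>. deriv (g \<epsilon>) (f \<epsilon>)) \<longlongrightarrow> (if 0 < x then 1 else 0)) (at_right 0)"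
proof (rule tendstoI)
  fix e :: real assume "e > 0"
  \<comment> \<open>With this radius the ball stays on one side of 0, where the indicator is
    constant.\<close>
  let ?K = "cball x (\<bar>x\<bar> / 2)"
  have ind: "indicator {0..} y = (if 0 < x then 1 else (0::real))" if "y \<in> ?K" for y
    using that assms(3) by (auto simp: dist_real_def indicator_def abs_if split: if_splits)
  have "0 \<notin> ?K"
    using assms(3) by (simp add: dist_real_def)
  then have "compact ?K \<and> ?K \<subseteq> UNIV - {0}"
    by auto
  then have "uniform_limit ?K (\<lambda>\<epsilon>. deriv (g \<epsilon>)) (indicator {0..}) (at_right 0)"
    using assms(1) unfolding admissible_smoothing_def by blast
  then have "eventually (\<lambda>\<epsilon>. \<forall>y\<in>?K. dist (deriv (g \<epsilon>) y) (indicator {0..} y) < e) (at_right 0)"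
    using \<open>e > 0\<close> by (rule uniform_limitD)
  moreover have "eventually (\<lambda>\<epsilon>. dist (f \<epsilon>) x < \<bar>x\<bar> / 2) (at_right 0)"
    using assms(2,3) by (intro tendstoD) auto
  ultimately show "eventually (\<lambda>\<epsilon>. dist (deriv (g \<epsilon>) (f \<epsilon>)) (if 0 < x then 1 else 0) < e) (at_right 0)"
  proof eventually_elim
    case (elim \<epsilon>)
    then have "f \<epsilon> \<in> ?K" by (simp add: dist_commute)
    then show ?case using elim(1) ind by metis
  qed
qed

lemma tendsto_step_deriv:
  assumes "admissible_smoothing g" "n \<ge> 1" "a (Suc n) \<noteq> vmin n a"
  shows "((\<lambda>\<epsilon>. deriv (g \<epsilon>) (a (Suc n) - smoothed_min (g \<epsilon>) n a)) \<longlongrightarrow>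
    (if vmin n a < a (Suc n) then 1 else 0)) (at_right 0)"
  using tendsto_admissible_deriv[OF assms(1)
      tendsto_diff[OF tendsto_const tendsto_smoothed_min[OF assms(1,2)]], of "a (Suc n)" a] assms(3)
  by simp

text \<open>At a tie the argument tends to 0, the point that the uniform convergence leaves out. It
  is nonpositive by \<open>smoothed_min_ge_vmin\<close> and eventually above \<open>-s0\<close>, so
  the supremum dominates the derivative.\<close>

lemma tendsto_step_deriv_tie:
  assumes "admissible_smoothing g" "n \<ge> 1" "a (Suc n) = vmin n a"
    and below: "\<And>\<epsilon> r. \<epsilon> > 0 \<Longrightarrow> g \<epsilon> r \<le> max r 0"
    and "s0 > 0"
    and sup: "((\<lambda>\<epsilon>. SUP s\<in>{-s0..0}. \<bar>deriv (g \<epsilon>) s\<bar>) \<longlongrightarrow> 0) (at_right 0)"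
  shows "((\<lambda>\<epsilon>. deriv (g \<epsilon>) (a (Suc n) - smoothed_min (g \<epsilon>) n a)) \<longlongrightarrow> 0) (at_right 0)"
proof (rule Lim_null_comparison[OF _ sup])
  have "eventually (\<lambda>\<epsilon>. dist (smoothed_min (g \<epsilon>) n a) (vmin n a) < s0) (at_right 0)"
    using tendsto_smoothed_min[OF assms(1,2)] \<open>s0 > 0\<close> by (rule tendstoD)
  with eventually_at_right_less[of "0::real"]
  show "eventually (\<lambda>\<epsilon>. norm (deriv (g \<epsilon>) (a (Suc n) - smoothed_min (g \<epsilon>) n a))
      \<le> (SUP s\<in>{-s0..0}. \<bar>deriv (g \<epsilon>) s\<bar>)) (at_right 0)"
  proof eventually_elim
    case (elim \<epsilon>)
    let ?x = "a (Suc n) - smoothed_min (g \<epsilon>) n a"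
    have "?x \<in> {-s0..0}"
      using elim(2) smoothed_min_ge_vmin[OF below[OF elim(1)] assms(2), of a] assms(3)
      by (simp add: dist_real_def)
    \<comment> \<open>A real \<open>SUP\<close> is known to be an upper bound only for a set bounded
      above.\<close>
    moreover have "bdd_above ((\<lambda>s. \<bar>deriv (g \<epsilon>) s\<bar>) ` {-s0..0})"
      using admissible_smoothing_deriv[OF assms(1) elim(1)] by (intro bdd_aboveI2[where M = 1]) auto
    ultimately show ?case
      unfolding real_norm_def by (rule cSUP_upper)
  qed
qed

section \<open>Limits of the partial derivatives across one recursion step\<close>

lemma tendsto_smoothed_min_partial_Suc_self:
  assumes "admissible_smoothing g" "n \<ge> 1"
    and d: "((\<lambda>\<epsilon>. deriv (g \<epsilon>) (a (Suc n) - smoothed_min (g \<epsilon>) n a)) \<longlongrightarrow> D) (at_right 0)"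
  shows "((\<lambda>\<epsilon>. smoothed_min_partial (g \<epsilon>) (Suc n) (Suc n) a) \<longlongrightarrow> 1 - D) (at_right 0)"
proof (rule Lim_transform_eventually[OF tendsto_diff[OF tendsto_const d]])
  show "eventually (\<lambda>\<epsilon>. 1 - deriv (g \<epsilon>) (a (Suc n) - smoothed_min (g \<epsilon>) n a) =
      smoothed_min_partial (g \<epsilon>) (Suc n) (Suc n) a) (at_right 0)"
    using eventually_at_right_less[of "0::real"]
    by eventually_elim (use assms in \<open>simp add: smoothed_min_partial_Suc
        smoothed_min_partial_beyond admissible_smoothing_C11\<close>)
qed

text \<open>Only one of the two factors has to converge if its limit is zero, as both lie in \<open>{0..1}\<close>.\<close>

lemma tendsto_smoothed_min_partial_Suc_zero:
  assumes "admissible_smoothing g" "n \<ge> 1" "j \<le> n"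
    and "((\<lambda>\<epsilon>. deriv (g \<epsilon>) (a (Suc n) - smoothed_min (g \<epsilon>) n a)) \<longlongrightarrow> 0) (at_right 0) \<or>
      ((\<lambda>\<epsilon>. smoothed_min_partial (g \<epsilon>) n j a) \<longlongrightarrow> 0) (at_right 0)"
  shows "((\<lambda>\<epsilon>. smoothed_min_partial (g \<epsilon>) (Suc n) j a) \<longlongrightarrow> 0) (at_right 0)"
proof -
  let ?d = "\<lambda>\<epsilon>. deriv (g \<epsilon>) (a (Suc n) - smoothed_min (g \<epsilon>) n a)"
  let ?p = "\<lambda>\<epsilon>. smoothed_min_partial (g \<epsilon>) n j a"
  have bound: "norm (smoothed_min_partial (g \<epsilon>) (Suc n) j a) \<le> ?d \<epsilon> \<and>
      norm (smoothed_min_partial (g \<epsilon>) (Suc n) j a) \<le> ?p \<epsilon>" if "\<epsilon> > 0" for \<epsilon>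
  proof -
    note C = admissible_smoothing_C11[OF assms(1) that]
    note unit = admissible_smoothing_deriv[OF assms(1) that]
    have "smoothed_min_partial (g \<epsilon>) (Suc n) j a = ?d \<epsilon> * ?p \<epsilon>"
      using assms(3) by (simp add: smoothed_min_partial_Suc[OF C assms(2)])
    then show ?thesis
      using unit[of "a (Suc n) - smoothed_min (g \<epsilon>) n a"]
        smoothed_min_partial_in_unit[OF C unit assms(2), of j a]
      by (simp add: mult_left_le mult_left_le_one_le)
  qed
  from assms(4) show ?thesis
  proof
    assume "(?d \<longlongrightarrow> 0) (at_right 0)"
    then show ?thesis
      by (rule Lim_null_comparison[rotated])
        (rule eventually_mono[OF eventually_at_right_less[of "0::real"]], use bound in blast)
  next
    assume "(?p \<longlongrightarrow> 0) (at_right 0)"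
    then show ?thesis
      by (rule Lim_null_comparison[rotated])
        (rule eventually_mono[OF eventually_at_right_less[of "0::real"]], use bound in blast)
  qed
qed

text \<open>Serves a new coordinate strictly above the old minimum, where earlier limits are
  inherited.\<close>

lemma tendsto_smoothed_min_partial_Suc_one:
  assumes "admissible_smoothing g" "n \<ge> 1" "j \<le> n"
    and d: "((\<lambda>\<epsilon>. deriv (g \<epsilon>) (a (Suc n) - smoothed_min (g \<epsilon>) n a)) \<longlongrightarrow> 1) (at_right 0)"
    and p: "((\<lambda>\<epsilon>. smoothed_min_partial (g \<epsilon>) n j a) \<longlongrightarrow> L) (at_right 0)"
  shows "((\<lambda>\<epsilon>. smoothed_min_partial (g \<epsilon>) (Suc n) j a) \<longlongrightarrow> L) (at_right 0)"
proof (rule Lim_transform_eventually)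
  show "((\<lambda>\<epsilon>. deriv (g \<epsilon>) (a (Suc n) - smoothed_min (g \<epsilon>) n a) * smoothed_min_partial (g \<epsilon>) n j a)
      \<longlongrightarrow> L) (at_right 0)"
    using tendsto_mult[OF d p] by simp
  show "eventually (\<lambda>\<epsilon>. deriv (g \<epsilon>) (a (Suc n) - smoothed_min (g \<epsilon>) n a) *
      smoothed_min_partial (g \<epsilon>) n j a = smoothed_min_partial (g \<epsilon>) (Suc n) j a) (at_right 0)"
    using eventually_at_right_less[of "0::real"]
    by eventually_elim (use assms in \<open>simp add: smoothed_min_partial_Suc admissible_smoothing_C11\<close>)
qed

section \<open>Limits of the partial derivatives for all coordinates\<close>

lemma tendsto_smoothed_min_partial_inactive:
  assumes "admissible_smoothing g" "n \<ge> 1" "j \<in> {1..n} - active_set n a"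
  shows "((\<lambda>\<epsilon>. smoothed_min_partial (g \<epsilon>) n j a) \<longlongrightarrow> 0) (at_right 0)"
  using assms(2,3)
proof (induction n rule: dec_induct)
  case base
  \<comment> \<open>A single coordinate is always active, so the premise is contradictory.\<close>
  then show ?case by (auto simp: active_set_def vmin_1 le_Suc_eq)
next
  case (step n)
  have n: "n \<ge> 1" using step.hyps by simp
  show ?case
  proof (cases "j = Suc n")
    case True
    then have "vmin n a < a (Suc n)"
      using step.prems n by (auto simp: active_set_def vmin_Suc)
    then show ?thesis
      using tendsto_smoothed_min_partial_Suc_self[OF assms(1) n tendsto_step_deriv[OF assms(1) n, of a]] True
      by simp
  next
    case False
    then have j: "j \<in> {1..n}" using step.prems by auto
    have "((\<lambda>\<epsilon>. deriv (g \<epsilon>) (a (Suc n) - smoothed_min (g \<epsilon>) n a)) \<longlongrightarrow> 0) (at_right 0) \<or>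
      ((\<lambda>\<epsilon>. smoothed_min_partial (g \<epsilon>) n j a) \<longlongrightarrow> 0) (at_right 0)"
    \<comment> \<open>A strictly smaller new coordinate sends the factor to 0. Otherwise the minimum
      is unchanged, so \<open>j\<close> was already inactive and the induction hypothesis
      applies.\<close>
    proof (cases "a (Suc n) < vmin n a")
      case True
      then show ?thesis using tendsto_step_deriv[OF assms(1) n, of a] by simp
    next
      case False
      then have "j \<in> {1..n} - active_set n a"
        using step.prems n j by (auto simp: active_set_def vmin_Suc)
      then show ?thesis using step.IH by simp
    qed
    then show ?thesis
      using tendsto_smoothed_min_partial_Suc_zero[OF assms(1) n] j by simp
  qed
qed

text \<open>All other partials vanish in the limit, which leaves the whole total 1 to
  \<open>k\<close>.\<close>

lemma tendsto_smoothed_min_partial_unique_active: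
  assumes "admissible_smoothing g" "n \<ge> 1" "active_set n a = {k}"
  shows "((\<lambda>\<epsilon>. smoothed_min_partial (g \<epsilon>) n k a) \<longlongrightarrow> 1) (at_right 0)"
proof -
  have k: "k \<in> {1..n}" using assms(3) by (auto simp: active_set_def)
  have "((\<lambda>\<epsilon>. 1 - (\<Sum>j\<in>{1..n} - {k}. smoothed_min_partial (g \<epsilon>) n j a)) \<longlongrightarrow>
      1 - (\<Sum>j\<in>{1..n} - {k}. 0)) (at_right 0)"
    using assms by (intro tendsto_intros tendsto_smoothed_min_partial_inactive) auto
  moreover have "eventually (\<lambda>\<epsilon>. 1 - (\<Sum>j\<in>{1..n} - {k}. smoothed_min_partial (g \<epsilon>) n j a) =
      smoothed_min_partial (g \<epsilon>) n k a) (at_right 0)"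
    using eventually_at_right_less[of "0::real"]
  proof eventually_elim
    case (elim \<epsilon>)
    then show ?case
      using sum_smoothed_min_partial[OF admissible_smoothing_C11[OF assms(1)] assms(2), of \<epsilon> a]
        sum.remove[OF finite_atLeastAtMost k, of "\<lambda>j. smoothed_min_partial (g \<epsilon>) n j a"]
      by simp
  qed
  ultimately show ?thesis by (simp add: Lim_transform_eventually)
qed

lemma tendsto_smoothed_min_partial_max_active:
  assumes "admissible_smoothing g" "n \<ge> 1" "j \<in> {1..n}"
    and below: "\<And>\<epsilon> r. \<epsilon> > 0 \<Longrightarrow> g \<epsilon> r \<le> max r 0"
    and "s0 > 0"
    and sup: "((\<lambda>\<epsilon>. SUP s\<in>{-s0..0}. \<bar>deriv (g \<epsilon>) s\<bar>) \<longlongrightarrow> 0) (at_right 0)"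
  shows "((\<lambda>\<epsilon>. smoothed_min_partial (g \<epsilon>) n j a) \<longlongrightarrow> (if j = max_active n a then 1 else 0)) (at_right 0)"
  using assms(2,3)
proof (induction n rule: dec_induct)
  case base
  then show ?case by (simp add: smoothed_min_partial_1 max_active_1)
next
  case (step n)
  have n: "n \<ge> 1" using step.hyps by simp
  \<comment> \<open>The extra hypotheses on \<open>g\<close> enter here: they give a tie the same
    limit 0 as a strictly smaller new coordinate.\<close>
  have d: "((\<lambda>\<epsilon>. deriv (g \<epsilon>) (a (Suc n) - smoothed_min (g \<epsilon>) n a)) \<longlongrightarrow>
      (if vmin n a < a (Suc n) then 1 else 0)) (at_right 0)"
    using tendsto_step_deriv[OF assms(1) n, of a]
      tendsto_step_deriv_tie[OF assms(1) n _ below \<open>s0 > 0\<close> sup, of a]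
    by (cases "a (Suc n) = vmin n a") auto
  show ?case
  proof (cases "j = Suc n")
    case True
    \<comment> \<open>If \<open>vmin n a < a (Suc n)\<close>, the largest active index is inherited
      from the first \<open>n\<close> coordinates, so it is not \<open>j\<close>, in accord with the
      limit \<open>1 - 1\<close>.\<close>
    have "max_active n a \<noteq> Suc n"
    proof -
      have "vmin n a \<in> a ` {1..n}"
        unfolding vmin_def using n by (intro Min_in) auto
      then have "active_set n a \<noteq> {}" by (auto simp: active_set_def)
      then have "max_active n a \<in> active_set n a"
        unfolding max_active_def by (intro Max_in) (auto simp: active_set_def)
      then show ?thesis by (auto simp: active_set_def)
    qed
    then show ?thesis
      using tendsto_smoothed_min_partial_Suc_self[OF assms(1) n d] True
      by (auto simp: max_active_Suc[OF n] split: if_splits)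
  next
    case False
    then have j: "j \<in> {1..n}" using step.prems by auto
    show ?thesis
    proof (cases "vmin n a < a (Suc n)")
      case True
      then show ?thesis
        using tendsto_smoothed_min_partial_Suc_one[OF assms(1) n _ _ step.IH[OF j]] d j
        by (simp add: max_active_Suc[OF n])
    next
      case False
      then show ?thesis
        using tendsto_smoothed_min_partial_Suc_zero[OF assms(1) n, of j a] d j
        by (simp add: max_active_Suc[OF n])
    qed
  qed
qed

theorem proposition3p1:
  fixes n :: nat and g :: "real \<Rightarrow> real \<Rightarrow> real" and a :: "nat \<Rightarrow> real"
  assumes "n \<ge> 1" and "admissible_smoothing g"
  shows
    "(\<forall>j \<in> {1..n} - active_set n a.
        ((\<lambda>\<epsilon>. smoothed_min_partial (g \<epsilon>) n j a) \<longlongrightarrow> 0) (at_right 0)) \<and>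
     (active_set n a = {max_active n a} \<longrightarrow>
        ((\<lambda>\<epsilon>. smoothed_min_partial (g \<epsilon>) n (max_active n a) a) \<longlongrightarrow> 1) (at_right 0)) \<and>
     ((\<forall>\<epsilon>>0. \<forall>r. g \<epsilon> r \<le> max r 0) \<and>
      (\<exists>s0>0. ((\<lambda>\<epsilon>. SUP s\<in>{-s0..0}. \<bar>deriv (g \<epsilon>) s\<bar>) \<longlongrightarrow> 0) (at_right 0)) \<longrightarrow>
        (\<forall>j \<in> {1..n}.
          ((\<lambda>\<epsilon>. smoothed_min_partial (g \<epsilon>) n j a) \<longlongrightarrow>
             (if j = max_active n a then 1 else 0)) (at_right 0)))"
proof (intro conjI impI ballI)
  fix j assume "j \<in> {1..n} - active_set n a"
  then show "((\<lambda>\<epsilon>. smoothed_min_partial (g \<epsilon>) n j a) \<longlongrightarrow> 0) (at_right 0)"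
    by (rule tendsto_smoothed_min_partial_inactive[OF assms(2,1)])
next
  assume "active_set n a = {max_active n a}"
  then show "((\<lambda>\<epsilon>. smoothed_min_partial (g \<epsilon>) n (max_active n a) a) \<longlongrightarrow> 1) (at_right 0)"
    by (rule tendsto_smoothed_min_partial_unique_active[OF assms(2,1)])
next
  fix j
  assume *: "(\<forall>\<epsilon>>0. \<forall>r. g \<epsilon> r \<le> max r 0) \<and>
      (\<exists>s0>0. ((\<lambda>\<epsilon>. SUP s\<in>{-s0..0}. \<bar>deriv (g \<epsilon>) s\<bar>) \<longlongrightarrow> 0) (at_right 0))"
    and j: "j \<in> {1..n}"
  then obtain s0 where "s0 > 0"
    and "((\<lambda>\<epsilon>. SUP s\<in>{-s0..0}. \<bar>deriv (g \<epsilon>) s\<bar>) \<longlongrightarrow> 0) (at_right 0)"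
    by blast
  with * show "((\<lambda>\<epsilon>. smoothed_min_partial (g \<epsilon>) n j a) \<longlongrightarrow>
      (if j = max_active n a then 1 else 0)) (at_right 0)"
    by (intro tendsto_smoothed_min_partial_max_active[OF assms(2,1) j]) auto
qed

end
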